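(* Let $G=(V,E)$ be any labeled graph, let $\varepsilon>0$ be a sufficiently small constant, and let $V=V_{\mathrm{sparse}}\sqcup K_1\sqcup\cdots\sqcup K_k$ be an $\varepsilon$-sparse-dense decomposition of the $(+)$-subgraph $G^+$. Let $\mathcal{A}$ be the clustering in which every vertex $v\in V_{\mathrm{sparse}}$ forms its own singleton cluster $\{v\}$ and each $K_i$ forms one cluster. Then $\mathcal{A}$ is an $O(\varepsilon^{-2})$-approximation for correlation clustering on $G$, i.e., its cost is at most $O(\varepsilon^{-2})$ times the minimum cost of any clustering of $G$.
   Context: A labeled graph $G=(V,E)$ is a complete undirected graph in which every edge is labeled $+1$ or $-1$; $G^+$ is the subgraph of $(+)$-edges, and $N^+(v)$, $\deg^+(v)$ are neighborhood and degree in $G^+$. For a clustering (partition of $V$), an edge costs $1$ if it is a $(+)$-edge between different clusters or a $(-)$-edge inside a cluster, and $0$ otherwise; the cost of the clustering is the sum of edge costs, and correlation clustering asks to minimize it. For a graph $H$ with neighborhoods $N(\cdot)$ and degrees $\deg(\cdot)$, and $A\triangle B=(A\setminus B)\cup(B\setminus A)$, an $\varepsilon$-sparse-dense decomposition of $H$ is a partition $V=V_{\mathrm{sparse}}\sqcup K_1\sqcup\cdots\sqcup K_k$ such that, for an absolute constant $\eta_0>0$: (a) every $v\in V_{\mathrm{sparse}}$ has a set $S(v)\subseteq N(v)$ with $|S(v)|\ge \eta_0\varepsilon\deg(v)$ such that every $u\in S(v)$ satisfies $|N(u)\triangle N(v)|\ge \eta_0\varepsilon\max\{\deg(u),\deg(v)\}$;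 (b) for each $K_i$ (an "almost-clique"), letting $\Delta(K_i)=\max_{v\in K_i}\deg(v)$: $(1-\varepsilon)\Delta(K_i)\le |K_i|\le(1+\varepsilon)\Delta(K_i)$, every vertex of $K_i$ has at most $\varepsilon\Delta(K_i)$ non-neighbors inside $K_i$, and every vertex of $K_i$ has at most $\varepsilon\Delta(K_i)$ neighbors outside $K_i$.
   Formalization: In condition (a), |N(u)△N(v)| is counted without u and v themselves; with open neighborhoods counted literally, a single isolated (+)-edge with both ends in V_sparse costs 1 against an optimum of 0, so the claim would fail. *)

theory Defs
  imports Complex_Main "HOL-Library.Disjoint_Sets"
begin

definition all_pairs :: "'a set \<Rightarrow> 'a set set" where
  "all_pairs V = {e. e \<subseteq> V \<and> card e = 2}"

definition labeled_graph :: "'a set \<Rightarrow> ('a set \<Rightarrow> int) \<Rightarrow> bool" where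
  "labeled_graph V lab \<longleftrightarrow> finite V \<and> (\<forall>e\<in>all_pairs V. lab e = 1 \<or> lab e = -1)"

definition plus_edges :: "'a set \<Rightarrow> ('a set \<Rightarrow> int) \<Rightarrow> 'a set set" where
  "plus_edges V lab = {e \<in> all_pairs V. lab e = 1}"

definition edge_cost :: "('a set \<Rightarrow> int) \<Rightarrow> 'a set set \<Rightarrow> 'a set \<Rightarrow> nat" where
  "edge_cost lab P e =
     (if (lab e = 1 \<and> \<not> (\<exists>X\<in>P. e \<subseteq> X)) \<or> (lab e = -1 \<and> (\<exists>X\<in>P. e \<subseteq> X)) then 1 else 0)"

definition clustering_cost :: "'a set \<Rightarrow> ('a set \<Rightarrow> int) \<Rightarrow> 'a set set \<Rightarrow> nat" where
  "clustering_cost V lab P = (\<Sum>e\<in>all_pairs V. edge_cost lab P e)"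

definition opt_cost :: "'a set \<Rightarrow> ('a set \<Rightarrow> int) \<Rightarrow> nat" where
  "opt_cost V lab = Min (clustering_cost V lab ` {P. partition_on V P})"

definition approximates_cc :: "real \<Rightarrow> 'a set \<Rightarrow> ('a set \<Rightarrow> int) \<Rightarrow> 'a set set \<Rightarrow> bool" where
  "approximates_cc \<alpha> V lab P \<longleftrightarrow>
     partition_on V P \<and> real (clustering_cost V lab P) \<le> \<alpha> * real (opt_cost V lab)"

definition nbhd :: "'a set set \<Rightarrow> 'a \<Rightarrow> 'a set" where
  "nbhd F v = {u. u \<noteq> v \<and> {u, v} \<in> F}"

definition deg :: "'a set set \<Rightarrow> 'a \<Rightarrow> nat" where
  "deg F v = card (nbhd F v)"

text \<open>
  The symmetric difference of the neighbourhoods of two adjacent vertices \<open>u\<close>, \<open>v\<close> is counted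
  over third vertices only. As neighbourhoods are open, \<open>u\<close> and \<open>v\<close> themselves always belong to it;
  if they counted, both ends of an isolated edge would be sparse for all small \<open>\<epsilon>\<close>, and clustering
  them as singletons costs 1 where the optimum is 0, so that no approximation ratio could hold.
\<close>

definition sparse_vertex :: "real \<Rightarrow> real \<Rightarrow> 'a set set \<Rightarrow> 'a \<Rightarrow> bool" where
  "sparse_vertex \<eta> \<epsilon> F v \<longleftrightarrow>
     (\<exists>S. S \<subseteq> nbhd F v \<and> real (card S) \<ge> \<eta> * \<epsilon> * real (deg F v) \<and>
       (\<forall>u\<in>S. real (card (sym_diff (nbhd F u) (nbhd F v) - {u, v}))
               \<ge> \<eta> * \<epsilon> * real (max (deg F u) (deg F v))))"

definition max_deg :: "'a set set \<Rightarrow> 'a set \<Rightarrow> nat" where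
  "max_deg F K = Max (deg F ` K)"

definition almost_clique :: "real \<Rightarrow> 'a set set \<Rightarrow> 'a set \<Rightarrow> bool" where
  "almost_clique \<epsilon> F K \<longleftrightarrow>
     (1 - \<epsilon>) * real (max_deg F K) \<le> real (card K) \<and>
     real (card K) \<le> (1 + \<epsilon>) * real (max_deg F K) \<and>
     (\<forall>v\<in>K. real (card {u \<in> K. u \<noteq> v \<and> u \<notin> nbhd F v}) \<le> \<epsilon> * real (max_deg F K)) \<and>
     (\<forall>v\<in>K. real (card (nbhd F v - K)) \<le> \<epsilon> * real (max_deg F K))"

definition sparse_dense_decomposition ::
  "real \<Rightarrow> real \<Rightarrow> 'a set \<Rightarrow> 'a set set \<Rightarrow> 'a set \<Rightarrow> 'a set set \<Rightarrow> bool" where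
  "sparse_dense_decomposition \<eta> \<epsilon> V F Vsparse Ks \<longleftrightarrow>
     Vsparse \<subseteq> V \<and> partition_on (V - Vsparse) Ks \<and>
     (\<forall>v\<in>Vsparse. sparse_vertex \<eta> \<epsilon> F v) \<and>
     (\<forall>K\<in>Ks. almost_clique \<epsilon> F K)"

definition decomposition_clustering :: "'a set \<Rightarrow> 'a set set \<Rightarrow> 'a set set" where
  "decomposition_clustering Vsparse Ks = (\<lambda>v. {v}) ` Vsparse \<union> Ks"

end

theory Submission
  imports Defs
begin

text \<open>
  Compare the clustering with an arbitrary clustering \<open>P\<close>, writing \<open>y v\<close> for the number of
  edges at \<open>v\<close> on which \<open>P\<close> pays, so that \<open>y\<close> sums to twice the cost of \<open>P\<close>. The engine is the
  bad triangle: if \<open>u\<close>, \<open>v\<close> share a cluster of \<open>P\<close>, then every third vertex in the symmetric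
  difference of their neighbourhoods causes a mistake at \<open>u\<close> or at \<open>v\<close>; if they do not, then every
  common neighbour does.

  For a sparse \<open>v\<close> and \<open>u \<in> S(v)\<close> this gives
  \<open>1 \<le> [P errs on uv] + (y u + y v) / (\<eta> \<epsilon> max (deg u) (deg v))\<close>. Summing over \<open>S(v)\<close> and then over \<open>v\<close>,
  each \<open>u\<close> is charged \<open>y u / deg u\<close> at most \<open>deg u\<close> times, so the degrees of the sparse vertices sum
  to \<open>O(cost P / (\<eta> \<epsilon>)\<^sup>2)\<close>.

  An edge \<open>uv\<close> between non-sparse vertices on which the decomposition pays lies in at least
  \<open>\<Delta> / 2\<close> bad triangles, where \<open>\<Delta>\<close> is the larger maximum degree of the two almost-cliques involved.
  Since a vertex of \<open>K\<close> is on at most \<open>2 \<epsilon> \<Delta>(K)\<close> such edges, their number is \<open>O(cost P)\<close>.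
\<close>

section \<open>Double counting over pairs\<close>

lemma all_pairs_insert:
  assumes "x \<notin> V"
  shows "all_pairs (insert x V) = all_pairs V \<union> (\<lambda>v. {x, v}) ` V"
proof (intro equalityI subsetI)
  fix e assume "e \<in> all_pairs (insert x V)"
  then have e: "e \<subseteq> insert x V" "card e = 2" by (auto simp: all_pairs_def)
  then obtain a b where ab: "e = {a, b}" "a \<noteq> b" by (auto simp: card_2_iff)
  with e show "e \<in> all_pairs V \<union> (\<lambda>v. {x, v}) ` V"
    by (auto simp: all_pairs_def)
next
  fix e assume "e \<in> all_pairs V \<union> (\<lambda>v. {x, v}) ` V"
  with assms show "e \<in> all_pairs (insert x V)"
    by (auto simp: all_pairs_def card_insert_if)
qed

lemma finite_all_pairs: "finite V \<Longrightarrow> finite (all_pairs V)"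
  by (rule finite_subset[of _ "Pow V"]) (auto simp: all_pairs_def)

text \<open>Turns a cost over unordered pairs into counts at single vertices. In the induction each
  new pair \<open>{x, v}\<close> appears once from \<open>x\<close> and once from
  \<open>v\<close>.\<close>

lemma sum_ordered_pairs:
  fixes f :: "'a set \<Rightarrow> nat"
  assumes "finite V"
  shows "(\<Sum>v\<in>V. \<Sum>u\<in>V - {v}. f {u, v}) = 2 * (\<Sum>e\<in>all_pairs V. f e)"
  using assms
proof (induction V rule: finite_induct)
  case empty
  then show ?case by (simp add: all_pairs_def)
next
  case (insert x V)
  have 1: "(\<Sum>u\<in>insert x V - {v}. f {u, v}) = f {x, v} + (\<Sum>u\<in>V - {v}. f {u, v})" if "v \<in> V" for v
  proof -
    have "insert x V - {v} = insert x (V - {v})" using that insert by auto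
    then show ?thesis using insert by simp
  qed
  have "(\<Sum>v\<in>insert x V. \<Sum>u\<in>insert x V - {v}. f {u, v})
      = (\<Sum>u\<in>V. f {u, x}) + (\<Sum>v\<in>V. f {x, v} + (\<Sum>u\<in>V - {v}. f {u, v}))"
    using insert by (simp add: 1)
  also have "\<dots> = 2 * (\<Sum>v\<in>V. f {x, v}) + 2 * (\<Sum>e\<in>all_pairs V. f e)"
    using insert.IH by (simp add: sum.distrib insert_commute[of _ x])
  also have "(\<Sum>v\<in>V. f {x, v}) = (\<Sum>e\<in>(\<lambda>v. {x, v}) ` V. f e)"
    by (subst sum.reindex) (auto simp: inj_on_def doubleton_eq_iff)
  also have "2 * \<dots> + 2 * (\<Sum>e\<in>all_pairs V. f e) = 2 * (\<Sum>e\<in>all_pairs (insert x V). f e)"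
    unfolding all_pairs_insert[OF insert.hyps(2)] using insert.hyps
    by (subst sum.union_disjoint) (auto simp: finite_all_pairs all_pairs_def)
  finally show ?case .
qed

text \<open>Discharging: instead of summing what \<open>u\<close> collects from its partners, sum
  what each \<open>v\<close> hands out, namely \<open>h v\<close> once per partner. It serves both
  for adjacency and for costly dense pairs.\<close>

lemma sum_symmetric_swap:
  fixes h :: "'a \<Rightarrow> real"
  assumes "finite D" and "\<And>u v. R u v \<longleftrightarrow> R v u"
  shows "(\<Sum>u\<in>D. \<Sum>v\<in>{v \<in> D. R u v}. h v) = (\<Sum>v\<in>D. real (card {u \<in> D. R v u}) * h v)"
proof -
  have "(\<Sum>u\<in>D. \<Sum>v\<in>{v \<in> D. R u v}. h v) = (\<Sum>v\<in>D. \<Sum>u\<in>{u \<in> D. R u v}. h v)"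
    by (rule sum.swap_restrict) (use assms in auto)
  then show ?thesis using assms(2) by simp
qed

section \<open>Adjacency, shared clusters and mistakes at a vertex\<close>

lemma nbhd_sym: "u \<in> nbhd F v \<longleftrightarrow> v \<in> nbhd F u"
  by (auto simp: nbhd_def insert_commute)

lemma nbhd_plus_edges:
  "u \<in> nbhd (plus_edges V lab) v \<longleftrightarrow> u \<in> V \<and> v \<in> V \<and> u \<noteq> v \<and> lab {u, v} = 1"
  by (auto simp: nbhd_def plus_edges_def all_pairs_def)

definition same_cluster :: "'a set set \<Rightarrow> 'a \<Rightarrow> 'a \<Rightarrow> bool" where
  "same_cluster P u v \<longleftrightarrow> (\<exists>X\<in>P. {u, v} \<subseteq> X)"

lemma same_cluster_sym: "same_cluster P u v \<longleftrightarrow> same_cluster P v u"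
  by (auto simp: same_cluster_def)

lemma same_cluster_trans:
  assumes "partition_on V P" "same_cluster P u v" "same_cluster P v w"
  shows "same_cluster P u w"
proof -
  obtain X Y where X: "X \<in> P" "{u, v} \<subseteq> X" and Y: "Y \<in> P" "{v, w} \<subseteq> Y"
    using assms by (auto simp: same_cluster_def)
  then have "X = Y" using assms(1) by (auto simp: partition_on_def disjoint_def)
  then show ?thesis using X Y by (auto simp: same_cluster_def)
qed

definition mistakes :: "'a set \<Rightarrow> ('a set \<Rightarrow> int) \<Rightarrow> 'a set set \<Rightarrow> 'a \<Rightarrow> 'a set" where
  "mistakes V lab P v = {u \<in> V. u \<noteq> v \<and> edge_cost lab P {u, v} = 1}"

lemma finite_mistakes: "finite V \<Longrightarrow> finite (mistakes V lab P v)"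
  by (simp add: mistakes_def)

lemma mistakes_sym: "u \<in> V \<Longrightarrow> v \<in> V \<Longrightarrow> u \<in> mistakes V lab P v \<longleftrightarrow> v \<in> mistakes V lab P u"
  by (auto simp: mistakes_def insert_commute)

text \<open>Labels on pairs are only 1 or -1, so a non-neighbour is joined by a minus edge and a
  mistake is exactly a disagreement between adjacency and sharing a cluster.\<close>

lemma mistakes_iff:
  assumes "labeled_graph V lab" "u \<in> V" "v \<in> V"
  shows "u \<in> mistakes V lab P v \<longleftrightarrow>
    u \<noteq> v \<and> (u \<in> nbhd (plus_edges V lab) v \<longleftrightarrow> \<not> same_cluster P u v)"
proof (cases "u = v")
  case False
  then have "{u, v} \<in> all_pairs V" using assms by (auto simp: all_pairs_def)
  then have "lab {u, v} = 1 \<or> lab {u, v} = -1" using assms by (auto simp: labeled_graph_def)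
  then show ?thesis using assms False
    by (auto simp: mistakes_def nbhd_plus_edges same_cluster_def edge_cost_def)
qed (simp add: mistakes_def)

lemma sum_card_mistakes:
  assumes "finite V"
  shows "(\<Sum>v\<in>V. card (mistakes V lab P v)) = 2 * clustering_cost V lab P"
proof -
  have "card (mistakes V lab P v) = (\<Sum>u\<in>V - {v}. edge_cost lab P {u, v})" for v
  proof -
    have "(\<Sum>u\<in>V - {v}. edge_cost lab P {u, v}) = (\<Sum>u\<in>mistakes V lab P v. edge_cost lab P {u, v})"
      using assms by (intro sum.mono_neutral_right) (auto simp: mistakes_def edge_cost_def)
    also have "\<dots> = (\<Sum>u\<in>mistakes V lab P v. 1)"
      by (rule sum.cong) (auto simp: mistakes_def)
    finally show ?thesis by simp
  qed
  then show ?thesis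
    using sum_ordered_pairs[OF assms] by (simp add: clustering_cost_def)
qed

lemma sum_real_card_mistakes:
  assumes "finite V"
  shows "(\<Sum>v\<in>V. real (card (mistakes V lab P v))) = 2 * real (clustering_cost V lab P)"
  using sum_card_mistakes[OF assms, of lab P] by (metis of_nat_mult of_nat_numeral of_nat_sum)

section \<open>Bad triangles\<close>

text \<open>By transitivity \<open>w\<close> is clustered with both of \<open>u\<close>,
  \<open>v\<close> or with neither, yet it is adjacent to exactly one of them.\<close>

lemma bad_triangle_together:
  assumes "labeled_graph V lab" "partition_on V P" "u \<in> V" "v \<in> V" "same_cluster P u v"
    and "w \<in> sym_diff (nbhd (plus_edges V lab) u) (nbhd (plus_edges V lab) v) - {u, v}"
  shows "w \<in> mistakes V lab P u \<union> mistakes V lab P v"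
proof -
  have "w \<in> V" using assms(6) by (auto simp: nbhd_plus_edges)
  moreover have "same_cluster P w u \<longleftrightarrow> same_cluster P w v"
    using assms(2,5) same_cluster_trans same_cluster_sym by metis
  ultimately show ?thesis using assms by (auto simp: mistakes_iff)
qed

text \<open>By transitivity \<open>w\<close> cannot be clustered with both \<open>u\<close> and
  \<open>v\<close>, so one of its plus edges to them is cut.\<close>

lemma bad_triangle_apart:
  assumes "labeled_graph V lab" "partition_on V P" "u \<in> V" "v \<in> V" "\<not> same_cluster P u v"
    and "w \<in> nbhd (plus_edges V lab) u \<inter> nbhd (plus_edges V lab) v"
  shows "w \<in> mistakes V lab P u \<union> mistakes V lab P v"
proof -
  have "w \<in> V" "w \<noteq> u" "w \<noteq> v" using assms(6) by (auto simp: nbhd_plus_edges)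
  moreover have "\<not> same_cluster P w u \<or> \<not> same_cluster P w v"
    using assms(2,5) same_cluster_trans same_cluster_sym by metis
  ultimately show ?thesis using assms by (auto simp: mistakes_iff)
qed

lemma card_le_mistakes:
  assumes "finite V" "T \<subseteq> mistakes V lab P u \<union> mistakes V lab P v"
  shows "real (card T) \<le> real (card (mistakes V lab P u)) + real (card (mistakes V lab P v))"
proof -
  have "card T \<le> card (mistakes V lab P u \<union> mistakes V lab P v)"
    using assms by (intro card_mono) (auto simp: finite_mistakes)
  also have "\<dots> \<le> card (mistakes V lab P u) + card (mistakes V lab P v)"
    by (rule card_Un_le)
  finally show ?thesis by linarith
qed

section \<open>Degrees of sparse vertices\<close>

text \<open>One factor \<open>\<eta> * \<epsilon>\<close> comes from the size of \<open>S\<close>,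
  the other from the symmetric differences.\<close>

lemma sparse_vertex_deg_le:
  fixes \<eta> \<epsilon> :: real
  assumes G: "labeled_graph V lab" and P: "partition_on V P" and v: "v \<in> V"
    and c: "0 < \<eta> * \<epsilon>" "\<eta> * \<epsilon> \<le> 1"
    and sp: "sparse_vertex \<eta> \<epsilon> (plus_edges V lab) v"
  defines "N \<equiv> nbhd (plus_edges V lab)" and "d \<equiv> deg (plus_edges V lab)"
    and "y \<equiv> \<lambda>v. real (card (mistakes V lab P v))"
  shows "(\<eta> * \<epsilon>)\<^sup>2 * real (d v) \<le> 2 * y v + (\<Sum>u\<in>N v. y u / real (d u))"
proof -
  define c where "c = \<eta> * \<epsilon>"
  have c0: "0 < c" "c \<le> 1" using c by (auto simp: c_def)
  have finV: "finite V" using G by (simp add: labeled_graph_def)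
  have NV: "N x \<subseteq> V" for x by (auto simp: N_def nbhd_plus_edges)
  have finN: "finite (N x)" for x using finite_subset[OF NV finV] .
  obtain S where S: "S \<subseteq> N v" "c * real (d v) \<le> real (card S)"
    and Su: "\<And>u. u \<in> S \<Longrightarrow> c * real (max (d u) (d v)) \<le> real (card (sym_diff (N u) (N v) - {u, v}))"
    using sp unfolding sparse_vertex_def N_def d_def c_def by blast
  have finS: "finite S" using S(1) finN finite_subset by blast
  have y0: "0 \<le> y x" for x by (simp add: y_def)
  \<comment> \<open>The charging inequality of the overview, multiplied by \<open>c\<close>. The
    indicator pays when \<open>P\<close> separates \<open>u\<close> and \<open>v\<close>, the
    quotients when it does not.\<close>
  have each: "c \<le> c * of_bool (u \<in> mistakes V lab P v) + (y u / real (d u) + y v / real (d v))"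
    if u: "u \<in> S" for u
  proof -
    have uN: "u \<in> N v" and uV: "u \<in> V" using S(1) u NV by auto
    then have "v \<in> N u" by (simp add: N_def nbhd_sym)
    with uN have dpos: "0 < d u" "0 < d v"
      using finN[of u] finN[of v] by (auto simp: d_def deg_def N_def card_gt_0_iff)
    have q0: "0 \<le> y u / real (d u)" "0 \<le> y v / real (d v)" using y0 by simp_all
    show ?thesis
    proof (cases "same_cluster P u v")
      case True
      have "sym_diff (N u) (N v) - {u, v} \<subseteq> mistakes V lab P u \<union> mistakes V lab P v"
        using bad_triangle_together[OF G P uV v True] unfolding N_def by blast
      from card_le_mistakes[OF finV this] Su[OF u]
      have le: "c * real (max (d u) (d v)) \<le> y u + y v" unfolding y_def by linarith
      have "c = c * real (max (d u) (d v)) / real (max (d u) (d v))" using dpos by simp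
      also have "\<dots> \<le> (y u + y v) / real (max (d u) (d v))"
        using le by (rule divide_right_mono) simp
      also have "\<dots> = y u / real (max (d u) (d v)) + y v / real (max (d u) (d v))"
        by (rule add_divide_distrib)
      \<comment> \<open>Passing from the maximum to each vertex's own degree makes the charge to
        \<open>u\<close> independent of \<open>v\<close>, as the later exchange of sums
        needs.\<close>
      also have "\<dots> \<le> y u / real (d u) + y v / real (d v)"
        using dpos y0 by (intro add_mono divide_left_mono) auto
      finally show ?thesis using c0 by (simp add: of_bool_def)
    next
      case False
      then have "u \<in> mistakes V lab P v"
        using mistakes_iff[OF G uV v] uN by (auto simp: N_def nbhd_plus_edges)
      then show ?thesis using q0 by simp
    qed
  qed
  have "c * (c * real (d v)) \<le> c * real (card S)" using S(2) c0 by simp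
  also have "\<dots> = (\<Sum>u\<in>S. c)" by simp
  also have "\<dots> \<le> (\<Sum>u\<in>S. c * of_bool (u \<in> mistakes V lab P v) + (y u / real (d u) + y v / real (d v)))"
    by (rule sum_mono) (rule each)
  also have "\<dots> = c * real (card (S \<inter> mistakes V lab P v)) + (\<Sum>u\<in>S. y u / real (d u))
      + real (card S) * (y v / real (d v))"
    using finS by (simp add: sum.distrib sum_distrib_left[symmetric] of_bool_def sum.If_cases Int_def)
  also have "\<dots> \<le> y v + (\<Sum>u\<in>N v. y u / real (d u)) + y v"
  proof (intro add_mono)
    have "real (card (S \<inter> mistakes V lab P v)) \<le> y v"
      using finite_mistakes[OF finV] unfolding y_def by (simp add: card_mono)
    then have "c * real (card (S \<inter> mistakes V lab P v)) \<le> 1 * y v"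
      using c0 by (intro mult_mono) auto
    then show "c * real (card (S \<inter> mistakes V lab P v)) \<le> y v" by simp
    show "(\<Sum>u\<in>S. y u / real (d u)) \<le> (\<Sum>u\<in>N v. y u / real (d u))"
      using S(1) finN y0 by (intro sum_mono2) auto
    have "card S \<le> d v" using S(1) finN unfolding d_def deg_def N_def by (simp add: card_mono)
    then have "real (card S) * (y v / real (d v)) \<le> real (d v) * (y v / real (d v))"
      using y0 by (intro mult_right_mono) auto
    \<comment> \<open>Only an inequality, since the quotient is 0 when
      \<open>d v = 0\<close>.\<close>
    also have "\<dots> \<le> y v" using y0 by simp
    finally show "real (card S) * (y v / real (d v)) \<le> y v" .
  qed
  finally show ?thesis by (simp add: c_def power2_eq_square)
qed

text \<open>After the exchange, \<open>u\<close> pays \<open>y u / deg u\<close> to each of its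
  \<open>deg u\<close> neighbours. With the term \<open>2 * y v\<close> this makes three times the
  sum of \<open>y\<close>, which is twice the cost; hence 6.\<close>

lemma sum_deg_sparse_le:
  fixes \<eta> \<epsilon> :: real
  assumes G: "labeled_graph V lab" and P: "partition_on V P" and W: "W \<subseteq> V"
    and c: "0 < \<eta> * \<epsilon>" "\<eta> * \<epsilon> \<le> 1"
    and sp: "\<And>v. v \<in> W \<Longrightarrow> sparse_vertex \<eta> \<epsilon> (plus_edges V lab) v"
  shows "(\<eta> * \<epsilon>)\<^sup>2 * (\<Sum>v\<in>W. real (deg (plus_edges V lab) v)) \<le> 6 * real (clustering_cost V lab P)"
proof -
  let ?N = "nbhd (plus_edges V lab)" and ?d = "deg (plus_edges V lab)"
    and ?y = "\<lambda>v. real (card (mistakes V lab P v))"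
  have finV: "finite V" using G by (simp add: labeled_graph_def)
  have N_eq: "?N v = {u \<in> V. u \<in> ?N v}" for v by (auto simp: nbhd_plus_edges)
  have "(\<eta> * \<epsilon>)\<^sup>2 * (\<Sum>v\<in>W. real (?d v)) = (\<Sum>v\<in>W. (\<eta> * \<epsilon>)\<^sup>2 * real (?d v))"
    by (rule sum_distrib_left)
  also have "\<dots> \<le> (\<Sum>v\<in>W. 2 * ?y v + (\<Sum>u\<in>?N v. ?y u / real (?d u)))"
    using W by (intro sum_mono sparse_vertex_deg_le[OF G P _ c sp]) auto
  \<comment> \<open>Neighbours of sparse vertices need not be sparse, so the sum is enlarged to all
    of \<open>V\<close> before adjacency is used symmetrically.\<close>
  also have "\<dots> \<le> (\<Sum>v\<in>V. 2 * ?y v + (\<Sum>u\<in>?N v. ?y u / real (?d u)))"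
    using W finV by (intro sum_mono2 add_nonneg_nonneg sum_nonneg) auto
  also have "\<dots> = 2 * (\<Sum>v\<in>V. ?y v) + (\<Sum>v\<in>V. \<Sum>u\<in>{u \<in> V. u \<in> ?N v}. ?y u / real (?d u))"
    using N_eq by (simp add: sum.distrib sum_distrib_left)
  also have "(\<Sum>v\<in>V. \<Sum>u\<in>{u \<in> V. u \<in> ?N v}. ?y u / real (?d u))
      = (\<Sum>u\<in>V. real (card {v \<in> V. v \<in> ?N u}) * (?y u / real (?d u)))"
    by (rule sum_symmetric_swap[OF finV]) (rule nbhd_sym)
  also have "\<dots> \<le> (\<Sum>u\<in>V. ?y u)"
    unfolding N_eq[symmetric] by (intro sum_mono) (simp add: deg_def)
  finally show ?thesis using sum_real_card_mistakes[OF finV, of lab P] by simp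
qed

section \<open>Costly pairs in almost-cliques\<close>

text \<open>The third vertices are taken from \<open>K\<close>, the almost-clique with the larger
  maximum degree. All but \<open>2 * \<epsilon> * D\<close> of them form a bad triangle with
  \<open>u\<close> and \<open>v\<close>: they are common neighbours if \<open>K = K'\<close>, and
  adjacent to \<open>u\<close> only if \<open>K \<noteq> K'\<close>.\<close>

lemma dense_pair_charge:
  fixes \<epsilon> :: real
  assumes G: "labeled_graph V lab" and P: "partition_on V P"
    and KV: "K \<subseteq> V" "K' \<subseteq> V" and disj: "K = K' \<or> K \<inter> K' = {}"
    and ac: "almost_clique \<epsilon> (plus_edges V lab) K" "almost_clique \<epsilon> (plus_edges V lab) K'"
    and eps: "0 < \<epsilon>" "\<epsilon> \<le> 1/10"
    and u: "u \<in> K" and v: "v \<in> K'" and uv: "u \<noteq> v"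
    and bad: "u \<in> nbhd (plus_edges V lab) v \<longleftrightarrow> K \<noteq> K'"
    and ord: "max_deg (plus_edges V lab) K' \<le> max_deg (plus_edges V lab) K"
    and no: "u \<notin> mistakes V lab P v"
  shows "real (max_deg (plus_edges V lab) K)
    \<le> 2 * (real (card (mistakes V lab P u)) + real (card (mistakes V lab P v)))"
proof -
  define N where "N = nbhd (plus_edges V lab)"
  define D where "D = real (max_deg (plus_edges V lab) K)"
  define D' where "D' = real (max_deg (plus_edges V lab) K')"
  define nn where "nn x = {w \<in> K. w \<noteq> x \<and> w \<notin> N x}" for x
  have finV: "finite V" using G by (simp add: labeled_graph_def)
  have finK: "finite K" using KV finV finite_subset by blast
  have finN: "finite (N x)" for x
    by (rule finite_subset[OF _ finV]) (auto simp: N_def nbhd_plus_edges)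
  have uV: "u \<in> V" and vV: "v \<in> V" using u v KV by auto
  have DD: "D' \<le> D" "0 \<le> D" using ord by (auto simp: D_def D'_def)
  have K_ge: "(1 - \<epsilon>) * D \<le> real (card K)" using ac by (simp add: almost_clique_def D_def)
  have nn_le: "real (card (nn x)) \<le> \<epsilon> * D" if "x \<in> K" for x
    using ac that by (simp add: almost_clique_def D_def nn_def N_def)
  \<comment> \<open>The vertices that fail because of \<open>v\<close>. For
    \<open>K \<noteq> K'\<close> disjointness puts every neighbour of \<open>v\<close> in
    \<open>K\<close> outside \<open>K'\<close>, hence into \<open>X\<close>.\<close>
  define X where "X = (if K = K' then nn v else N v - K')"
  have X_le: "real (card X) \<le> \<epsilon> * D"
  proof (cases "K = K'")
    case True
    then show ?thesis using nn_le v by (simp add: X_def)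
  next
    case False
    then have "real (card X) \<le> \<epsilon> * D'" using ac v by (simp add: almost_clique_def D'_def X_def N_def)
    also have "\<dots> \<le> \<epsilon> * D" using DD eps by simp
    finally show ?thesis .
  qed
  have "K - nn u - X \<subseteq> mistakes V lab P u \<union> mistakes V lab P v"
  proof
    fix w assume w: "w \<in> K - nn u - X"
    show "w \<in> mistakes V lab P u \<union> mistakes V lab P v"
    proof (cases "K = K'")
      case True
      then have notN: "u \<notin> N v" "v \<notin> N u" using bad by (auto simp: N_def nbhd_sym)
      then have "\<not> same_cluster P u v"
        using no mistakes_iff[OF G uV vV] uv by (auto simp: N_def)
      \<comment> \<open>As \<open>u\<close> and \<open>v\<close> are non-adjacent members of
        \<open>K\<close>, each lies in the set of non-neighbours removed for the other.\<close>
      moreover have "w \<noteq> u" "w \<noteq> v"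
        using w notN True u v uv by (auto simp: X_def nn_def)
      then have "w \<in> N u \<inter> N v" using w True by (auto simp: X_def nn_def)
      ultimately show ?thesis using bad_triangle_apart[OF G P uV vV] by (simp add: N_def)
    next
      case False
      then have uN: "u \<in> N v" using bad by (simp add: N_def)
      then have same: "same_cluster P u v"
        using no mistakes_iff[OF G uV vV] uv by (auto simp: N_def)
      have "u \<in> X" using uN False disj u by (auto simp: X_def)
      then have "w \<noteq> u" using w by auto
      moreover have "w \<notin> K'" using w False disj by auto
      ultimately have "w \<in> N u" "w \<notin> N v" "w \<notin> {u, v}" using w v False by (auto simp: X_def nn_def)
      then have "w \<in> sym_diff (N u) (N v) - {u, v}" by auto
      then show ?thesis using bad_triangle_together[OF G P uV vV same] by (simp add: N_def)
    qed
  qed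
  then have T_le: "real (card (K - nn u - X))
      \<le> real (card (mistakes V lab P u)) + real (card (mistakes V lab P v))"
    by (rule card_le_mistakes[OF finV])
  have "finite (nn u)" "finite X" using finK finN by (auto simp: nn_def X_def)
  then have "card K \<le> card (K - nn u - X) + card (nn u) + card X"
    using diff_card_le_card_Diff[of "nn u" K] diff_card_le_card_Diff[of X "K - nn u"] by linarith
  then have "(1 - \<epsilon>) * D \<le> real (card (K - nn u - X)) + \<epsilon> * D + \<epsilon> * D"
    using K_ge X_le nn_le[OF u] by linarith
  \<comment> \<open>At least \<open>(1 - 3 * \<epsilon>) * D\<close> third vertices remain, which is
    no less than \<open>7/10 * D\<close>.\<close>
  moreover have "\<epsilon> * D \<le> 1/10 * D" using eps DD by (intro mult_right_mono) auto
  ultimately have "D \<le> 2 * real (card (K - nn u - X))" using DD by (simp add: algebra_simps)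
  then show ?thesis using T_le by (simp add: D_def)
qed

section \<open>The decomposition as a clustering and its cost on dense pairs\<close>

lemma decomposition_clustering_partition:
  assumes "sparse_dense_decomposition \<eta> \<epsilon> V F W Ks"
  shows "partition_on V (decomposition_clustering W Ks)"
proof -
  have W: "W \<subseteq> V" and Ks: "partition_on (V - W) Ks"
    using assms by (auto simp: sparse_dense_decomposition_def)
  have "partition_on W ((\<lambda>v. {v}) ` W)"
    by (auto simp: partition_on_def disjoint_def)
  then have "partition_on (W \<union> (V - W)) ((\<lambda>v. {v}) ` W \<union> Ks)"
    using Ks by (auto simp: partition_on_def intro!: disjoint_union)
  moreover have "W \<union> (V - W) = V" using W by auto
  ultimately show ?thesis by (simp add: decomposition_clustering_def)
qed

lemma same_cluster_decomposition:
  assumes "u \<noteq> v"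
  shows "same_cluster (decomposition_clustering W Ks) u v \<longleftrightarrow> (\<exists>K\<in>Ks. u \<in> K \<and> v \<in> K)"
  using assms by (auto simp: same_cluster_def decomposition_clustering_def)

text \<open>Each costly dense pair is charged to a mistake of \<open>P\<close> on the pair itself or
  to the two ends with weight \<open>h\<close>. The mistakes and the two ends each contribute at
  most the sum of \<open>y\<close>, which is twice the cost of \<open>P\<close>; hence 6.\<close>

lemma sum_dense_mistakes_le:
  fixes \<eta> \<epsilon> :: real
  assumes G: "labeled_graph V lab" and P: "partition_on V P"
    and dec: "sparse_dense_decomposition \<eta> \<epsilon> V (plus_edges V lab) W Ks"
    and eps: "0 < \<epsilon>" "\<epsilon> \<le> 1/10"
  shows "(\<Sum>u\<in>V - W. real (card (mistakes V lab (decomposition_clustering W Ks) u - W)))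
    \<le> 6 * real (clustering_cost V lab P)"
proof -
  let ?N = "nbhd (plus_edges V lab)" and ?A = "decomposition_clustering W Ks"
    and ?y = "\<lambda>v. real (card (mistakes V lab P v))"
  define D where "D = V - W"
  have finV: "finite V" using G by (simp add: labeled_graph_def)
  have finD: "finite D" using finV by (simp add: D_def)
  have Ks: "partition_on D Ks" and ac: "\<And>K. K \<in> Ks \<Longrightarrow> almost_clique \<epsilon> (plus_edges V lab) K"
    using dec by (auto simp: sparse_dense_decomposition_def D_def)
  have disj: "K = K' \<or> K \<inter> K' = {}" if "K \<in> Ks" "K' \<in> Ks" for K K'
    using Ks that by (auto simp: partition_on_def disjoint_def)
  have KV: "K \<subseteq> V" if "K \<in> Ks" for K
    using Ks that by (auto simp: partition_on_def D_def)
  have "\<forall>u\<in>D. \<exists>K. K \<in> Ks \<and> u \<in> K" using Ks by (auto simp: partition_on_def)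
  then obtain k where k: "\<And>u. u \<in> D \<Longrightarrow> k u \<in> Ks" "\<And>u. u \<in> D \<Longrightarrow> u \<in> k u"
    by metis
  define m where "m u = real (max_deg (plus_edges V lab) (k u))" for u
  \<comment> \<open>The upper size bound rules out maximum degree 0 for a nonempty almost-clique, so
    dividing by \<open>m u\<close> is meaningful.\<close>
  have mpos: "0 < m u" if "u \<in> D" for u
  proof -
    have "0 < card (k u)"
      using k[OF that] KV[OF k(1)[OF that]] finV by (auto simp: card_gt_0_iff intro: finite_subset)
    moreover have "real (card (k u)) \<le> (1 + \<epsilon>) * m u"
      using ac[OF k(1)[OF that]] by (simp add: almost_clique_def m_def)
    ultimately have "m u \<noteq> 0" by (intro notI) simp
    then show ?thesis by (simp add: m_def)
  qed
  have same: "same_cluster ?A u v \<longleftrightarrow> k u = k v" if "u \<in> D" "v \<in> D" "u \<noteq> v" for u v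
  proof -
    have "k u = K \<and> k v = K" if "K \<in> Ks" "u \<in> K" "v \<in> K" for K
      using disj[OF that(1) k(1)[OF \<open>u \<in> D\<close>]] disj[OF that(1) k(1)[OF \<open>v \<in> D\<close>]]
        k(2)[OF \<open>u \<in> D\<close>] k(2)[OF \<open>v \<in> D\<close>] that by auto
    then show ?thesis
      unfolding same_cluster_decomposition[OF that(3)] using k that by metis
  qed
  \<comment> \<open>Membership of both ends in \<open>D\<close> is built in so that \<open>R\<close>
    is symmetric without side conditions.\<close>
  define R where "R u v \<longleftrightarrow> u \<in> D \<and> v \<in> D \<and> v \<in> mistakes V lab ?A u" for u v
  have R_sym: "R u v \<longleftrightarrow> R v u" for u v
    using mistakes_sym[of u V v lab ?A] by (auto simp: R_def D_def)
  have R_iff: "u \<noteq> v \<and> (u \<in> ?N v \<longleftrightarrow> k u \<noteq> k v)" if "R u v" for u v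
  proof -
    have "u \<in> D" "v \<in> D" "u \<in> V" "v \<in> V" "u \<in> mistakes V lab ?A v"
      using that R_sym[of u v] by (auto simp: R_def D_def)
    then show ?thesis using mistakes_iff[OF G, of u v ?A] same[of u v] by auto
  qed
  define B where "B u = {v \<in> D. R u v}" for u
  have finB: "finite (B u)" for u using finD by (simp add: B_def)
  \<comment> \<open>The weight results from dividing the bound of \<open>dense_pair_charge\<close>
    by the maximum degree.\<close>
  define h where "h u = 2 * ?y u / m u" for u
  have h0: "0 \<le> h u" for u by (simp add: h_def m_def)
  have charge: "1 \<le> of_bool (v \<in> mistakes V lab P u) + (h u + h v)" if r: "R u v" for u v
  proof (cases "v \<in> mistakes V lab P u")
    case True
    then show ?thesis using h0 by simp
  next
    case no: False
    \<comment> \<open>Dividing by the larger value \<open>m a\<close> is safe for both ends, since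
      \<open>m b \<le> m a\<close> only increases the share of \<open>b\<close>. The opposite order
      follows from the symmetry of \<open>R\<close>.\<close>
    have half: "1 \<le> h a + h b" if r: "R a b" and ord: "m b \<le> m a" and no: "a \<notin> mistakes V lab P b" for a b
    proof -
      have ab: "a \<in> D" "b \<in> D" using r by (auto simp: R_def)
      have "m a \<le> 2 * (?y a + ?y b)"
        unfolding m_def
        by (rule dense_pair_charge[OF G P KV KV disj ac ac eps, of "k a" "k b"])
          (use ab k r R_iff ord no in \<open>auto simp: m_def\<close>)
      then have "1 \<le> 2 * (?y a + ?y b) / m a" using mpos ab by (simp add: field_simps)
      also have "\<dots> = h a + 2 * ?y b / m a" by (simp add: h_def add_divide_distrib)
      also have "\<dots> \<le> h a + h b"
        unfolding h_def using ord mpos ab by (intro add_left_mono divide_left_mono) auto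
      finally show ?thesis .
    qed
    have "u \<in> V" "v \<in> V" using r by (auto simp: R_def D_def)
    then have no': "u \<notin> mistakes V lab P v" using no mistakes_sym by metis
    show ?thesis
    proof (cases "m v \<le> m u")
      case True
      then show ?thesis using half[OF r] no' no by simp
    next
      case False
      then show ?thesis using half[of v u] R_sym r no by simp
    qed
  qed
  \<comment> \<open>The costly dense partners of \<open>u\<close> are non-neighbours inside
    \<open>k u\<close> or neighbours outside it, at most \<open>2 * \<epsilon> * m u\<close> in all.
    This is at most \<open>m u / 2\<close>, which cancels the factor \<open>2 / m u\<close> in
    \<open>h u\<close>.\<close>
  have B_le: "real (card (B u)) * h u \<le> ?y u" if u: "u \<in> D" for u
  proof -
    let ?nn = "{w \<in> k u. w \<noteq> u \<and> w \<notin> ?N u}" and ?out = "?N u - k u"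
    have "B u \<subseteq> ?nn \<union> ?out"
    proof
      fix v assume "v \<in> B u"
      then have "R u v" "v \<in> D" by (auto simp: B_def)
      then have "v \<noteq> u \<and> (v \<in> ?N u \<longleftrightarrow> k u \<noteq> k v)" using R_iff[of u v] nbhd_sym by metis
      moreover have "v \<in> k u \<longleftrightarrow> k u = k v"
        using disj[OF k(1)[OF u] k(1)[OF \<open>v \<in> D\<close>]] k(2)[OF \<open>v \<in> D\<close>] by auto
      ultimately show "v \<in> ?nn \<union> ?out" by auto
    qed
    moreover have "finite (?nn \<union> ?out)"
      using KV[OF k(1)[OF u]] by (intro finite_subset[OF _ finV]) (auto simp: nbhd_plus_edges)
    ultimately have "card (B u) \<le> card ?nn + card ?out"
      using card_mono card_Un_le order_trans by meson
    moreover have "real (card ?nn) \<le> \<epsilon> * m u" "real (card ?out) \<le> \<epsilon> * m u"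
      using ac[OF k(1)[OF u]] k(2)[OF u] by (auto simp: almost_clique_def m_def)
    ultimately have "real (card (B u)) \<le> 2 * \<epsilon> * m u" by linarith
    also have "\<dots> \<le> (1/2) * m u" using eps mpos[OF u] by (intro mult_right_mono) auto
    finally have "real (card (B u)) * h u \<le> (1/2) * m u * h u" using h0 by (rule mult_right_mono)
    also have "\<dots> = ?y u" using mpos[OF u] by (simp add: h_def)
    finally show ?thesis .
  qed
  have "(\<Sum>u\<in>D. real (card (B u))) = (\<Sum>u\<in>D. \<Sum>v\<in>B u. 1)" by simp
  also have "\<dots> \<le> (\<Sum>u\<in>D. \<Sum>v\<in>B u. of_bool (v \<in> mistakes V lab P u) + (h u + h v))"
    by (intro sum_mono charge) (auto simp: B_def)
  also have "\<dots> = (\<Sum>u\<in>D. real (card (B u \<inter> mistakes V lab P u))) + (\<Sum>u\<in>D. real (card (B u)) * h u)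
      + (\<Sum>u\<in>D. \<Sum>v\<in>B u. h v)"
    using finB by (simp add: sum.distrib of_bool_def sum.If_cases Int_def)
  also have "(\<Sum>u\<in>D. \<Sum>v\<in>B u. h v) = (\<Sum>v\<in>D. real (card (B v)) * h v)"
    unfolding B_def by (rule sum_symmetric_swap[OF finD R_sym])
  also have "(\<Sum>u\<in>D. real (card (B u \<inter> mistakes V lab P u))) + (\<Sum>u\<in>D. real (card (B u)) * h u)
      + (\<Sum>u\<in>D. real (card (B u)) * h u) \<le> (\<Sum>u\<in>D. ?y u) + (\<Sum>u\<in>D. ?y u) + (\<Sum>u\<in>D. ?y u)"
    using B_le finite_mistakes[OF finV] by (intro add_mono sum_mono) (auto intro!: card_mono)
  also have "\<dots> \<le> 3 * (\<Sum>u\<in>V. ?y u)"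
    using sum_mono2[OF finV, of D ?y] by (auto simp: D_def)
  finally have "(\<Sum>u\<in>D. real (card (B u))) \<le> 6 * real (clustering_cost V lab P)"
    using sum_real_card_mistakes[OF finV, of lab P] by simp
  moreover have "B u = mistakes V lab ?A u - W" if "u \<in> D" for u
    using that by (auto simp: B_def R_def D_def mistakes_def)
  ultimately show ?thesis by (simp add: D_def)
qed

section \<open>Splitting the cost of the decomposition clustering\<close>

text \<open>A singleton cluster contains no pair, so its vertex errs only on plus edges.\<close>

lemma mistakes_at_sparse:
  assumes G: "labeled_graph V lab"
    and dec: "sparse_dense_decomposition \<eta> \<epsilon> V (plus_edges V lab) W Ks"
    and v: "v \<in> W"
  shows "mistakes V lab (decomposition_clustering W Ks) v \<subseteq> nbhd (plus_edges V lab) v"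
proof
  fix u assume u: "u \<in> mistakes V lab (decomposition_clustering W Ks) v"
  have "v \<in> V" "\<And>K. K \<in> Ks \<Longrightarrow> v \<notin> K"
    using dec v by (auto simp: sparse_dense_decomposition_def partition_on_def)
  moreover have "u \<in> V" "u \<noteq> v" using u by (auto simp: mistakes_def)
  ultimately show "u \<in> nbhd (plus_edges V lab) v"
    using mistakes_iff[OF G, of u v "decomposition_clustering W Ks"]
      same_cluster_decomposition[of u v] u by auto
qed

text \<open>Mistakes are counted from both ends. Those between a sparse and a dense vertex are
  bounded from the sparse end both times, which doubles the degree sum.\<close>

lemma clustering_cost_decomposition_le:
  fixes \<eta> \<epsilon> :: real
  assumes G: "labeled_graph V lab"
    and dec: "sparse_dense_decomposition \<eta> \<epsilon> V (plus_edges V lab) W Ks"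
  shows "2 * real (clustering_cost V lab (decomposition_clustering W Ks))
    \<le> 2 * (\<Sum>v\<in>W. real (deg (plus_edges V lab) v))
      + (\<Sum>u\<in>V - W. real (card (mistakes V lab (decomposition_clustering W Ks) u - W)))"
proof -
  let ?M = "mistakes V lab (decomposition_clustering W Ks)" and ?d = "deg (plus_edges V lab)"
  have finV: "finite V" using G by (simp add: labeled_graph_def)
  have W: "W \<subseteq> V" using dec by (auto simp: sparse_dense_decomposition_def)
  have finW: "finite W" using W finV finite_subset by blast
  have fin: "finite (nbhd (plus_edges V lab) v)" for v
    by (rule finite_subset[OF _ finV]) (auto simp: nbhd_plus_edges)
  have M_le: "real (card (?M v)) \<le> real (?d v)" if "v \<in> W" for v
    using mistakes_at_sparse[OF G dec that] fin by (simp add: deg_def card_mono)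
  have "(\<Sum>u\<in>V - W. card (?M u \<inter> W)) = (\<Sum>u\<in>V - W. \<Sum>v\<in>{v \<in> W. v \<in> ?M u}. 1)"
    by (simp add: Int_def conj_commute)
  also have "\<dots> = (\<Sum>v\<in>W. \<Sum>u\<in>{u \<in> V - W. v \<in> ?M u}. 1)"
    using finV finW by (intro sum.swap_restrict) auto
  also have "\<dots> \<le> (\<Sum>v\<in>W. card (?M v))"
    using W mistakes_sym[of _ V] finite_mistakes[OF finV]
    by (intro sum_mono) (auto intro!: card_mono)
  finally have cross: "(\<Sum>u\<in>V - W. real (card (?M u \<inter> W))) \<le> (\<Sum>v\<in>W. real (card (?M v)))"
    by (metis of_nat_le_iff of_nat_sum)
  have "2 * real (clustering_cost V lab (decomposition_clustering W Ks)) = (\<Sum>v\<in>V. real (card (?M v)))"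
    using sum_real_card_mistakes[OF finV] by simp
  also have "\<dots> = (\<Sum>v\<in>W. real (card (?M v))) + (\<Sum>v\<in>V - W. real (card (?M v)))"
    using sum.subset_diff[OF W finV] by (simp add: add.commute)
  also have "(\<Sum>v\<in>V - W. real (card (?M v)))
      = (\<Sum>v\<in>V - W. real (card (?M v \<inter> W)) + real (card (?M v - W)))"
    using finite_mistakes[OF finV]
    by (intro sum.cong refl) (metis card_Int_Diff of_nat_add)
  finally have "2 * real (clustering_cost V lab (decomposition_clustering W Ks))
      \<le> 2 * (\<Sum>v\<in>W. real (card (?M v))) + (\<Sum>v\<in>V - W. real (card (?M v - W)))"
    using cross by (simp add: sum.distrib)
  moreover have "(\<Sum>v\<in>W. real (card (?M v))) \<le> (\<Sum>v\<in>W. real (?d v))"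
    by (rule sum_mono) (rule M_le)
  ultimately show ?thesis by linarith
qed

section \<open>The optimum and the approximation ratio\<close>

text \<open>The minimum is over a finite set, nonempty because of the partition into
  singletons.\<close>

lemma opt_cost_attained:
  assumes "finite V"
  obtains P where "partition_on V P" "opt_cost V lab = clustering_cost V lab P"
proof -
  have "{P. partition_on V P} \<subseteq> Pow (Pow V)" by (auto simp: partition_on_def)
  then have fin: "finite {P. partition_on V P}" using assms finite_subset by blast
  have "partition_on V ((\<lambda>v. {v}) ` V)" by (auto simp: partition_on_def disjoint_def)
  then have "opt_cost V lab \<in> clustering_cost V lab ` {P. partition_on V P}"
    unfolding opt_cost_def using fin by (intro Min_in) auto
  then show thesis using that by auto
qed

theorem theorem4p1:
  fixes \<eta>\<^sub>0 :: real
  assumes "\<eta>\<^sub>0 > 0"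
  shows "\<exists>\<epsilon>\<^sub>0>0. \<exists>C>0. \<forall>\<epsilon>::real. 0 < \<epsilon> \<and> \<epsilon> \<le> \<epsilon>\<^sub>0 \<longrightarrow>
    (\<forall>(V :: 'a set) (lab :: 'a set \<Rightarrow> int) Vsparse Ks.
       labeled_graph V lab \<longrightarrow>
       sparse_dense_decomposition \<eta>\<^sub>0 \<epsilon> V (plus_edges V lab) Vsparse Ks \<longrightarrow>
       approximates_cc (C / \<epsilon>\<^sup>2) V lab (decomposition_clustering Vsparse Ks))"
proof -
  \<comment> \<open>The bound \<open>1/10\<close> serves the dense pairs;
    \<open>1/\<eta>\<^sub>0\<close> ensures \<open>\<eta>\<^sub>0 * \<epsilon> \<le> 1\<close> for
    the sparse vertices.\<close>
  define e where "e = min (1/10) (1/\<eta>\<^sub>0)"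
  \<comment> \<open>The first summand pays for the sparse degrees; 3 is half of the 6 for dense
    pairs, each of which is counted twice there. Since \<open>\<epsilon>\<^sup>2 \<le> 1\<close>,
    the dense part also fits under division by \<open>\<epsilon>\<^sup>2\<close>.\<close>
  define C where "C = 6 / \<eta>\<^sub>0\<^sup>2 + 3"
  have "approximates_cc (C / \<epsilon>\<^sup>2) V lab (decomposition_clustering W Ks)"
    if eps: "0 < \<epsilon>" "\<epsilon> \<le> e" and G: "labeled_graph V lab"
      and dec: "sparse_dense_decomposition \<eta>\<^sub>0 \<epsilon> V (plus_edges V lab) W Ks"
    for \<epsilon> :: real and V :: "'a set" and lab W Ks
  proof -
    have eps': "\<epsilon> \<le> 1/10" "0 < \<eta>\<^sub>0 * \<epsilon>" "\<eta>\<^sub>0 * \<epsilon> \<le> 1"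
      using eps assms by (auto simp: e_def field_simps)
    have "finite V" using G by (simp add: labeled_graph_def)
    then obtain P where P: "partition_on V P" and opt: "opt_cost V lab = clustering_cost V lab P"
      by (rule opt_cost_attained)
    define c where "c = real (clustering_cost V lab P)"
    define s where "s = (\<Sum>v\<in>W. real (deg (plus_edges V lab) v))"
    have "(\<eta>\<^sub>0 * \<epsilon>)\<^sup>2 * s \<le> 6 * c"
      unfolding s_def c_def using dec
      by (intro sum_deg_sparse_le[OF G P _ eps'(2,3)]) (auto simp: sparse_dense_decomposition_def)
    then have "s \<le> 6 * c / (\<eta>\<^sub>0 * \<epsilon>)\<^sup>2" using assms eps by (simp add: pos_le_divide_eq mult.commute)
    moreover have "3 * c \<le> 3 * c / \<epsilon>\<^sup>2"
    proof -
      have "\<epsilon>\<^sup>2 \<le> 1" using eps eps' by (simp add: power_le_one)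
      then have "c * \<epsilon>\<^sup>2 \<le> c" by (simp add: c_def mult_left_le)
      then show ?thesis using eps by (simp add: field_simps)
    qed
    moreover have "real (clustering_cost V lab (decomposition_clustering W Ks)) \<le> s + 3 * c"
      using clustering_cost_decomposition_le[OF G dec] sum_dense_mistakes_le[OF G P dec eps(1) eps'(1)]
      unfolding s_def c_def by linarith
    moreover have "C / \<epsilon>\<^sup>2 * c = 6 * c / (\<eta>\<^sub>0 * \<epsilon>)\<^sup>2 + 3 * c / \<epsilon>\<^sup>2"
      using assms eps by (simp add: C_def power_mult_distrib field_simps)
    ultimately show ?thesis
      using decomposition_clustering_partition[OF dec] opt
      by (simp add: approximates_cc_def c_def)
  qed
  moreover have "e > 0" "C > 0" using assms by (auto simp: e_def C_def add_nonneg_pos)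
  ultimately show ?thesis by blast
qed

end
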